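(* Let $X$ be a compact metric space and $\varphi:\mathbb{T}^+\times X\to X$ a dynamical system. The set $\mathsf{Att}(\varphi)$ of attractors is a sublattice of the bounded distributive lattice $\mathsf{Invset}(\varphi)$ of invariant sets, and the mapping $\omega:\mathsf{ANbhd}(\varphi)\to\mathsf{Att}(\varphi)$, $U\mapsto\omega(U)$, is a surjective lattice homomorphism.
   Context: $\mathbb{T}$ is $\mathbb{Z}$ or $\mathbb{R}$, $\mathbb{T}^+=\{t\in\mathbb{T}:t\ge0\}$. A dynamical system is a continuous map $\varphi:\mathbb{T}^+\times X\to X$ with $\varphi(0,x)=x$ and $\varphi(t,\varphi(s,x))=\varphi(t+s,x)$ for $s,t\in\mathbb{T}^+$ (no invertibility assumed). $S\subset X$ is invariant if $\varphi(t,S)=S$ for all $t\ge0$, forward invariant if $\varphi(t,S)\subset S$ for all $t\ge0$. $\mathrm{Inv}(U)$ is the union of all invariant subsets of $U$. $\mathsf{Invset}(\varphi)$ is the set of all invariant sets, a bounded distributive lattice with $S\vee S'=S\cup S'$, $S\wedge S'=\mathrm{Inv}(S\cap S')$, $0=\varnothing$, $1=\mathrm{Inv}(X)$. For $U\subset X$, $\omega(U)=\bigcap_{t\ge0}\mathrm{cl}\big(\bigcup_{s\ge t}\varphi(s,U)\big)$. $U\subset X$ is an attracting neighborhood if $\omega(U)\subset\mathrm{int}(U)$; the set $\mathsf{ANbhd}(\varphi)$ of attracting neighborhoods is a bounded distributive lattice under $\cup,\cap$ with $0=\varnothing$, $1=X$. A trapping region is a forward invariant $U\subset X$ with $\varphi(\tau,\mathrm{cl}(U))\subset\mathrm{int}(U)$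 for some $\tau>0$; an attractor is a set $\mathrm{Inv}(U)$ with $U$ a trapping region. Sublattices of bounded lattices must contain $0$ and $1$; homomorphisms of bounded lattices must preserve $0$ and $1$. *)

theory Defs
  imports "HOL-Analysis.Analysis"
begin

text \<open>
  Bounded lattices are given by an explicit carrier and explicit operations, because the
  operations of the lattices below are prescribed and their carriers are proper subsets of a
  powerset.
\<close>

record 'b blat =
  car :: "'b set"
  join :: "'b \<Rightarrow> 'b \<Rightarrow> 'b"
  meet :: "'b \<Rightarrow> 'b \<Rightarrow> 'b"
  zero :: 'b
  one :: 'b

locale bdd_lattice =
  fixes L :: "'b blat"
  assumes join_closed: "\<lbrakk>x \<in> car L; y \<in> car L\<rbrakk> \<Longrightarrow> join L x y \<in> car L"
    and meet_closed: "\<lbrakk>x \<in> car L; y \<in> car L\<rbrakk> \<Longrightarrow> meet L x y \<in> car L"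
    and zero_closed: "zero L \<in> car L"
    and one_closed: "one L \<in> car L"
    and join_assoc: "\<lbrakk>x \<in> car L; y \<in> car L; z \<in> car L\<rbrakk>
          \<Longrightarrow> join L (join L x y) z = join L x (join L y z)"
    and meet_assoc: "\<lbrakk>x \<in> car L; y \<in> car L; z \<in> car L\<rbrakk>
          \<Longrightarrow> meet L (meet L x y) z = meet L x (meet L y z)"
    and join_commute: "\<lbrakk>x \<in> car L; y \<in> car L\<rbrakk> \<Longrightarrow> join L x y = join L y x"
    and meet_commute: "\<lbrakk>x \<in> car L; y \<in> car L\<rbrakk> \<Longrightarrow> meet L x y = meet L y x"
    and join_meet_absorb: "\<lbrakk>x \<in> car L; y \<in> car L\<rbrakk> \<Longrightarrow> join L x (meet L x y) = x"
    and meet_join_absorb: "\<lbrakk>x \<in> car L; y \<in> car L\<rbrakk> \<Longrightarrow> meet L x (join L x y) = x"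
    and join_zero: "x \<in> car L \<Longrightarrow> join L x (zero L) = x"
    and meet_one: "x \<in> car L \<Longrightarrow> meet L x (one L) = x"

locale bdd_distrib_lattice = bdd_lattice +
  assumes meet_join_distrib: "\<lbrakk>x \<in> car L; y \<in> car L; z \<in> car L\<rbrakk>
          \<Longrightarrow> meet L x (join L y z) = join L (meet L x y) (meet L x z)"

locale bdd_sublattice = bdd_lattice L for L :: "'b blat" +
  fixes K :: "'b set"
  assumes sub_subset: "K \<subseteq> car L"
    and sub_join: "\<lbrakk>x \<in> K; y \<in> K\<rbrakk> \<Longrightarrow> join L x y \<in> K"
    and sub_meet: "\<lbrakk>x \<in> K; y \<in> K\<rbrakk> \<Longrightarrow> meet L x y \<in> K"
    and sub_zero: "zero L \<in> K"
    and sub_one: "one L \<in> K"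

locale bdd_lattice_hom = dom: bdd_lattice L + cod: bdd_lattice M
  for L :: "'b blat" and M :: "'c blat" +
  fixes h :: "'b \<Rightarrow> 'c"
  assumes hom_closed: "x \<in> car L \<Longrightarrow> h x \<in> car M"
    and hom_join: "\<lbrakk>x \<in> car L; y \<in> car L\<rbrakk> \<Longrightarrow> h (join L x y) = join M (h x) (h y)"
    and hom_meet: "\<lbrakk>x \<in> car L; y \<in> car L\<rbrakk> \<Longrightarrow> h (meet L x y) = meet M (h x) (h y)"
    and hom_zero: "h (zero L) = zero M"
    and hom_one: "h (one L) = one M"

text \<open>
  The phase space is the subspace \<open>X\<close> of a metric space type (so \<open>X\<close> may be empty), and all
  closures and interiors are relative to \<open>X\<close>. Discrete time is \<open>\<int>\<close> as a subspace of the reals.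
  Only values \<open>\<phi> t x\<close> with \<open>t\<close> in \<open>Tplus T\<close> and \<open>x\<close> in \<open>X\<close> are ever used.
\<close>

definition Tplus :: "real set \<Rightarrow> real set" where
  "Tplus T = {t \<in> T. 0 \<le> t}"

locale dynamical_system =
  fixes T :: "real set" and X :: "'a::metric_space set" and \<phi> :: "real \<Rightarrow> 'a \<Rightarrow> 'a"
  assumes time: "T = \<int> \<or> T = UNIV"
    and maps_to: "\<lbrakk>t \<in> Tplus T; x \<in> X\<rbrakk> \<Longrightarrow> \<phi> t x \<in> X"
    and continuous: "continuous_on (Tplus T \<times> X) (\<lambda>(t, x). \<phi> t x)"
    and initial: "x \<in> X \<Longrightarrow> \<phi> 0 x = x"
    and semigroup: "\<lbrakk>s \<in> Tplus T; t \<in> Tplus T; x \<in> X\<rbrakk> \<Longrightarrow> \<phi> t (\<phi> s x) = \<phi> (t + s) x"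

definition invariant_set ::
    "real set \<Rightarrow> 'a set \<Rightarrow> (real \<Rightarrow> 'a \<Rightarrow> 'a) \<Rightarrow> 'a set \<Rightarrow> bool" where
  "invariant_set T X \<phi> S \<longleftrightarrow> S \<subseteq> X \<and> (\<forall>t\<in>Tplus T. \<phi> t ` S = S)"

definition forward_invariant ::
    "real set \<Rightarrow> 'a set \<Rightarrow> (real \<Rightarrow> 'a \<Rightarrow> 'a) \<Rightarrow> 'a set \<Rightarrow> bool" where
  "forward_invariant T X \<phi> S \<longleftrightarrow> S \<subseteq> X \<and> (\<forall>t\<in>Tplus T. \<phi> t ` S \<subseteq> S)"

definition Inv :: "real set \<Rightarrow> 'a set \<Rightarrow> (real \<Rightarrow> 'a \<Rightarrow> 'a) \<Rightarrow> 'a set \<Rightarrow> 'a set" where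
  "Inv T X \<phi> U = \<Union>{S. invariant_set T X \<phi> S \<and> S \<subseteq> U}"

definition omega ::
    "real set \<Rightarrow> 'a::metric_space set \<Rightarrow> (real \<Rightarrow> 'a \<Rightarrow> 'a) \<Rightarrow> 'a set \<Rightarrow> 'a set" where
  "omega T X \<phi> U =
     (\<Inter>t\<in>Tplus T. top_of_set X closure_of (\<Union>s\<in>{s \<in> Tplus T. t \<le> s}. \<phi> s ` U))"

definition attracting_nbhd ::
    "real set \<Rightarrow> 'a::metric_space set \<Rightarrow> (real \<Rightarrow> 'a \<Rightarrow> 'a) \<Rightarrow> 'a set \<Rightarrow> bool" where
  "attracting_nbhd T X \<phi> U \<longleftrightarrow> U \<subseteq> X \<and> omega T X \<phi> U \<subseteq> top_of_set X interior_of U"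

definition trapping_region ::
    "real set \<Rightarrow> 'a::metric_space set \<Rightarrow> (real \<Rightarrow> 'a \<Rightarrow> 'a) \<Rightarrow> 'a set \<Rightarrow> bool" where
  "trapping_region T X \<phi> U \<longleftrightarrow> forward_invariant T X \<phi> U \<and>
     (\<exists>\<tau>\<in>T. 0 < \<tau> \<and> \<phi> \<tau> ` (top_of_set X closure_of U) \<subseteq> top_of_set X interior_of U)"

definition Att :: "real set \<Rightarrow> 'a::metric_space set \<Rightarrow> (real \<Rightarrow> 'a \<Rightarrow> 'a) \<Rightarrow> 'a set set" where
  "Att T X \<phi> = {Inv T X \<phi> U |U. trapping_region T X \<phi> U}"

definition Invset :: "real set \<Rightarrow> 'a set \<Rightarrow> (real \<Rightarrow> 'a \<Rightarrow> 'a) \<Rightarrow> 'a set blat" where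
  "Invset T X \<phi> =
     \<lparr>car = {S. invariant_set T X \<phi> S}, join = (\<union>), meet = (\<lambda>S S'. Inv T X \<phi> (S \<inter> S')),
      zero = {}, one = Inv T X \<phi> X\<rparr>"

definition ANbhd ::
    "real set \<Rightarrow> 'a::metric_space set \<Rightarrow> (real \<Rightarrow> 'a \<Rightarrow> 'a) \<Rightarrow> 'a set blat" where
  "ANbhd T X \<phi> =
     \<lparr>car = {U. attracting_nbhd T X \<phi> U}, join = (\<union>), meet = (\<inter>), zero = {}, one = X\<rparr>"

end

theory Submission
  imports Defs
begin

text \<open>
  For an attracting neighbourhood \<open>U\<close> the limit set \<open>\<omega>(U)\<close> is itself an invariant subset of \<open>U\<close>,
  and every invariant subset of \<open>U\<close> lies in \<open>\<omega>(U)\<close>; hence \<open>\<omega>(U) = Inv(U)\<close>. As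
  \<open>Inv(Inv(A) \<inter> Inv(B)) = Inv(A \<inter> B)\<close>, the map \<open>\<omega>\<close> preserves meets, and it preserves joins because
  \<open>\<omega>\<close> is additive. A trapping region is an attracting neighbourhood. Conversely, the points of an
  attracting neighbourhood \<open>U\<close> whose forward orbits stay in \<open>U\<close> form a trapping region with the
  same maximal invariant set: only a compact time interval matters for the condition, so the
  points satisfying it are a neighbourhood of \<open>\<omega>(U)\<close>. Distributivity of the invariant sets holds
  since a backward orbit in the union of two forward invariant sets lies entirely in one of them.
\<close>

section \<open>Invariant sets\<close>

lemma Inv_subset: "Inv T X \<phi> U \<subseteq> U"
  unfolding Inv_def by blast

lemma Inv_mono: "U \<subseteq> V \<Longrightarrow> Inv T X \<phi> U \<subseteq> Inv T X \<phi> V"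
  unfolding Inv_def by blast

lemma invariant_Inv: "invariant_set T X \<phi> (Inv T X \<phi> U)"
  unfolding Inv_def invariant_set_def by (auto simp: image_Union)

lemma Inv_maximal: "invariant_set T X \<phi> S \<Longrightarrow> S \<subseteq> U \<Longrightarrow> S \<subseteq> Inv T X \<phi> U"
  unfolding Inv_def by blast

lemma Inv_eq_self: "invariant_set T X \<phi> S \<Longrightarrow> Inv T X \<phi> S = S"
  by (simp add: Inv_maximal Inv_subset subset_antisym)

text \<open>An invariant subset of \<open>A \<inter> B\<close> already lies in
  \<open>Inv T X \<phi> A\<close>, so a factor may be replaced by its invariant part. Associativity
  of the meet and the preservation of meets by \<open>omega\<close> both come from this.\<close>

lemma Inv_Int_Inv_left: "Inv T X \<phi> (Inv T X \<phi> A \<inter> B) = Inv T X \<phi> (A \<inter> B)"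
proof
  show "Inv T X \<phi> (Inv T X \<phi> A \<inter> B) \<subseteq> Inv T X \<phi> (A \<inter> B)"
    by (rule Inv_mono) (use Inv_subset in fastforce)
  have "Inv T X \<phi> (A \<inter> B) \<subseteq> Inv T X \<phi> A \<inter> B"
    using Inv_subset[of T X \<phi> "A \<inter> B"] Inv_mono[of "A \<inter> B" A] by blast
  then show "Inv T X \<phi> (A \<inter> B) \<subseteq> Inv T X \<phi> (Inv T X \<phi> A \<inter> B)"
    by (rule Inv_maximal[OF invariant_Inv])
qed

lemma Inv_Int_Inv_right: "Inv T X \<phi> (A \<inter> Inv T X \<phi> B) = Inv T X \<phi> (A \<inter> B)"
  using Inv_Int_Inv_left[of T X \<phi> B A] by (simp add: Int_commute)

lemma invariant_set_Un:
  "invariant_set T X \<phi> A \<Longrightarrow> invariant_set T X \<phi> B \<Longrightarrow> invariant_set T X \<phi> (A \<union> B)"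
  unfolding invariant_set_def by (auto simp: image_Un)

lemma invariant_set_empty: "invariant_set T X \<phi> {}"
  unfolding invariant_set_def by simp

text \<open>Without invertibility, the preimages of a common point may lie in different sets, so an
  intersection of invariant sets can fail to be invariant. Forward invariance survives, and
  \<open>Inv_Un\<close> is stated for it so that distributivity can be deduced.\<close>

lemma forward_invariant_Int:
  "invariant_set T X \<phi> A \<Longrightarrow> invariant_set T X \<phi> B \<Longrightarrow> forward_invariant T X \<phi> (A \<inter> B)"
  unfolding invariant_set_def forward_invariant_def by blast

context dynamical_system
begin

lemma Tplus_nonneg: "t \<in> Tplus T \<Longrightarrow> 0 \<le> t"
  by (simp add: Tplus_def)

lemma Tplus_add: "s \<in> Tplus T \<Longrightarrow> t \<in> Tplus T \<Longrightarrow> s + t \<in> Tplus T"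
  using time by (auto simp: Tplus_def)

lemma Tplus_diff: "s \<in> Tplus T \<Longrightarrow> t \<in> Tplus T \<Longrightarrow> s \<le> t \<Longrightarrow> t - s \<in> Tplus T"
  using time by (auto simp: Tplus_def)

lemma Tplus_of_nat: "real n \<in> Tplus T"
  using time by (auto simp: Tplus_def)

lemma Tplus_closed: "closed (Tplus T)"
proof -
  have "Tplus T = T \<inter> {0..}" by (auto simp: Tplus_def)
  moreover have "closed T" using time by auto
  ultimately show ?thesis by (simp add: closed_Int)
qed

lemma image_subset_X: "t \<in> Tplus T \<Longrightarrow> U \<subseteq> X \<Longrightarrow> \<phi> t ` U \<subseteq> X"
  using maps_to by blast

lemma image_image_flow:
  assumes "s \<in> Tplus T" "t \<in> Tplus T" "U \<subseteq> X"
  shows "\<phi> t ` \<phi> s ` U = \<phi> (t + s) ` U"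
  using semigroup[OF assms(1,2)] assms(3) by (force simp: image_image intro!: image_cong)

lemma continuous_on_flow:
  assumes "t \<in> Tplus T" shows "continuous_on X (\<phi> t)"
proof -
  have "continuous_on X ((\<lambda>(t, x). \<phi> t x) \<circ> (\<lambda>x. (t, x)))"
    by (intro continuous_on_compose continuous_intros continuous_on_subset[OF continuous])
       (use assms in auto)
  then show ?thesis by (simp add: o_def)
qed

section \<open>Backward orbits and distributivity of the invariant sets\<close>

lemma invariant_set_backward_orbit:
  assumes "invariant_set T X \<phi> S" "p \<in> S"
  obtains \<gamma> :: "nat \<Rightarrow> 'a" where "\<gamma> 0 = p" "\<And>n. \<gamma> n \<in> S" "\<And>n. \<phi> 1 (\<gamma> (Suc n)) = \<gamma> n"
proof -
  have "\<exists>y. y \<in> S \<and> \<phi> 1 y = x" if "x \<in> S" for x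
  proof -
    have "\<phi> 1 ` S = S"
      using assms(1) Tplus_of_nat[of 1] by (simp add: invariant_set_def)
    then have "x \<in> \<phi> 1 ` S" using that by simp
    then show ?thesis by blast
  qed
  \<comment> \<open>Preimages under the time-one map are chosen one after another; the conjunct for
    \<open>n = 0\<close> fixes the starting point.\<close>
  then have "\<exists>\<gamma>. \<forall>n. (\<gamma> n \<in> S \<and> (n = 0 \<longrightarrow> \<gamma> n = p)) \<and> \<phi> 1 (\<gamma> (Suc n)) = \<gamma> n"
    using assms(2) by (intro dependent_nat_choice) auto
  then show ?thesis using that by metis
qed

lemma backward_orbit_add:
  assumes X: "\<And>n. \<gamma> n \<in> X" and pre: "\<And>n. \<phi> 1 (\<gamma> (Suc n)) = \<gamma> n"
  shows "\<phi> (real m) (\<gamma> (n + m)) = \<gamma> n"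
proof (induction m)
  case 0
  then show ?case using initial X by simp
next
  case (Suc m)
  have "\<phi> (real m) (\<phi> 1 (\<gamma> (Suc (n + m)))) = \<phi> (real m + 1) (\<gamma> (Suc (n + m)))"
    using semigroup[of 1 "real m"] Tplus_of_nat[of 1] Tplus_of_nat[of m] X by simp
  then show ?case using Suc pre by (simp add: add.commute)
qed

text \<open>All forward orbits of the points \<open>\<gamma> n\<close> together form an invariant
  set: a preimage at time \<open>t\<close> is found by starting further back along
  \<open>\<gamma>\<close>.\<close>

lemma backward_orbit_in_Inv:
  assumes X: "\<And>n. \<gamma> n \<in> X" and pre: "\<And>n. \<phi> 1 (\<gamma> (Suc n)) = \<gamma> n"
    and fwd: "forward_invariant T X \<phi> A" and A: "\<And>n. \<gamma> n \<in> A"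
  shows "\<gamma> 0 \<in> Inv T X \<phi> A"
proof -
  define S where "S = {\<phi> s (\<gamma> n) | s n. s \<in> Tplus T}"
  have "\<phi> t ` S = S" if t: "t \<in> Tplus T" for t
  proof
    show "\<phi> t ` S \<subseteq> S"
      using t semigroup Tplus_add X unfolding S_def by fastforce
    show "S \<subseteq> \<phi> t ` S"
    proof
      fix x assume "x \<in> S"
      then obtain s n where s: "s \<in> Tplus T" and x: "x = \<phi> s (\<gamma> n)" unfolding S_def by blast
      obtain m :: nat where m: "t \<le> real m" using real_arch_simple by blast
      \<comment> \<open>Chosen so that \<open>t + r = s + real m\<close>: starting \<open>m\<close>
        steps further back pays for the extra time \<open>t\<close>, and
        \<open>t \<le> real m\<close> keeps \<open>r\<close> nonnegative.\<close>
      define r where "r = s + (real m - t)"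
      have r: "r \<in> Tplus T" unfolding r_def
        by (intro Tplus_add Tplus_diff s t m Tplus_of_nat)
      have "\<phi> t (\<phi> r (\<gamma> (n + m))) = \<phi> (s + real m) (\<gamma> (n + m))"
        using semigroup[OF r t X] by (simp add: r_def algebra_simps)
      also have "\<dots> = \<phi> s (\<phi> (real m) (\<gamma> (n + m)))"
        using semigroup[OF Tplus_of_nat s X] by simp
      also have "\<dots> = x"
        using backward_orbit_add[where \<gamma> = \<gamma>, OF X pre] x by simp
      finally show "x \<in> \<phi> t ` S" using r unfolding S_def by blast
    qed
  qed
  moreover have "S \<subseteq> A" "S \<subseteq> X"
    using fwd A maps_to X unfolding S_def forward_invariant_def by blast+
  moreover have "\<gamma> 0 \<in> S"
    using initial[OF X, of 0] Tplus_of_nat[of 0] unfolding S_def by (auto intro!: exI[of _ 0])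
  ultimately show ?thesis
    unfolding Inv_def invariant_set_def by blast
qed

text \<open>A backward orbit in \<open>A \<union> B\<close> visits one of the two sets at infinitely
  many indices. Forward invariance then keeps the entire orbit in that set, and
  \<open>backward_orbit_in_Inv\<close> applies.\<close>

lemma Inv_Un:
  assumes A: "forward_invariant T X \<phi> A" and B: "forward_invariant T X \<phi> B"
  shows "Inv T X \<phi> (A \<union> B) = Inv T X \<phi> A \<union> Inv T X \<phi> B"
proof
  show "Inv T X \<phi> A \<union> Inv T X \<phi> B \<subseteq> Inv T X \<phi> (A \<union> B)"
    by (simp add: Inv_mono)
  show "Inv T X \<phi> (A \<union> B) \<subseteq> Inv T X \<phi> A \<union> Inv T X \<phi> B"
  proof
    fix p assume p: "p \<in> Inv T X \<phi> (A \<union> B)"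
    obtain \<gamma> where \<gamma>: "\<gamma> 0 = p" "\<And>n. \<gamma> n \<in> Inv T X \<phi> (A \<union> B)"
        and pre: "\<And>n. \<phi> 1 (\<gamma> (Suc n)) = \<gamma> n"
      using invariant_set_backward_orbit[OF invariant_Inv p] by metis
    have AB: "\<gamma> n \<in> A \<union> B" for n
      using \<gamma>(2)[of n] Inv_subset[of T X \<phi> "A \<union> B"] by blast
    then have X: "\<gamma> n \<in> X" for n
      using A B unfolding forward_invariant_def by blast
    \<comment> \<open>Larger indices lie further back in time, so flowing for time
      \<open>m - n\<close> from a visit at index \<open>m\<close> leads to \<open>\<gamma> n\<close>
      without leaving \<open>C\<close>.\<close>
    have all: "\<gamma> n \<in> C" if "forward_invariant T X \<phi> C" "\<forall>n. \<exists>m\<ge>n. \<gamma> m \<in> C" for C n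
    proof -
      obtain m where m: "m \<ge> n" "\<gamma> m \<in> C" using \<open>\<forall>n. \<exists>m\<ge>n. \<gamma> m \<in> C\<close> by blast
      have "\<phi> (real (m - n)) (\<gamma> m) = \<gamma> n"
        using backward_orbit_add[where \<gamma> = \<gamma>, OF X pre, of "m - n" n] m(1) by simp
      then show ?thesis
        using \<open>forward_invariant T X \<phi> C\<close> m(2) Tplus_of_nat unfolding forward_invariant_def
        by (metis image_subset_iff)
    qed
    have "(\<forall>n. \<exists>m\<ge>n. \<gamma> m \<in> A) \<or> (\<forall>n. \<exists>m\<ge>n. \<gamma> m \<in> B)"
    proof (rule ccontr)
      assume "\<not> ?thesis"
      then obtain i j where "\<forall>m\<ge>i. \<gamma> m \<notin> A" "\<forall>m\<ge>j. \<gamma> m \<notin> B" by blast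
      then show False using AB[of "max i j"] by simp
    qed
    then show "p \<in> Inv T X \<phi> A \<union> Inv T X \<phi> B"
      using backward_orbit_in_Inv[where \<gamma> = \<gamma>, OF X pre] all A B \<gamma>(1) by blast
  qed
qed

lemma bdd_distrib_lattice_Invset: "bdd_distrib_lattice (Invset T X \<phi>)"
proof (unfold_locales, simp_all only: Invset_def blat.simps mem_Collect_eq)
  fix x y z
  assume inv: "invariant_set T X \<phi> x" "invariant_set T X \<phi> y"
  show "invariant_set T X \<phi> (x \<union> y)" using inv by (rule invariant_set_Un)
  show "invariant_set T X \<phi> (Inv T X \<phi> (x \<inter> y))" by (rule invariant_Inv)
  show "Inv T X \<phi> (x \<inter> y) = Inv T X \<phi> (y \<inter> x)" by (simp add: Int_commute)
  show "x \<union> Inv T X \<phi> (x \<inter> y) = x" using Inv_subset by fastforce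
  show "Inv T X \<phi> (x \<inter> (x \<union> y)) = x" using inv by (simp add: Inv_eq_self Int_absorb2)
  assume z: "invariant_set T X \<phi> z"
  show "Inv T X \<phi> (Inv T X \<phi> (x \<inter> y) \<inter> z) = Inv T X \<phi> (x \<inter> Inv T X \<phi> (y \<inter> z))"
    by (simp add: Inv_Int_Inv_left Inv_Int_Inv_right Int_assoc)
  show "Inv T X \<phi> (x \<inter> (y \<union> z)) = Inv T X \<phi> (x \<inter> y) \<union> Inv T X \<phi> (x \<inter> z)"
    using Inv_Un[OF forward_invariant_Int[OF inv] forward_invariant_Int[OF inv(1) z]]
    by (simp add: Int_Un_distrib)
next
  fix x assume "invariant_set T X \<phi> x"
  then show "Inv T X \<phi> (x \<inter> Inv T X \<phi> X) = x"
    by (simp add: Inv_Int_Inv_right Inv_eq_self invariant_set_def Int_absorb2)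
qed (auto intro: invariant_set_empty invariant_Inv)

end

section \<open>Limit sets\<close>

lemma compact_decseq_Inter_nonempty:
  fixes F :: "nat \<Rightarrow> 'a::t2_space set"
  assumes F: "\<And>n. compact (F n)" "\<And>n. F n \<noteq> {}" and mono: "\<And>m n. m \<le> n \<Longrightarrow> F n \<subseteq> F m"
  shows "(\<Inter>n. F n) \<noteq> {}"
proof -
  have "F 0 \<inter> (\<Inter>n. F n) \<noteq> {}"
  proof (rule compact_imp_fip_image[OF F(1)])
    show "closed (F n)" for n
      by (rule compact_imp_closed[OF F(1)])
    fix I :: "nat set" assume "finite I"
    \<comment> \<open>Inserting 0 keeps \<open>Max\<close> meaningful when \<open>I\<close> is
      empty.\<close>
    then have "F (Max (insert 0 I)) \<subseteq> F 0 \<inter> (\<Inter>n\<in>I. F n)"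
      by (intro Int_greatest INT_greatest mono Max_ge) auto
    then show "F 0 \<inter> (\<Inter>n\<in>I. F n) \<noteq> {}"
      using F(2) by blast
  qed
  then show ?thesis by blast
qed

locale compact_dynamical_system = dynamical_system +
  assumes compact_space: "compact X"
begin

text \<open>These are the sets intersected in \<open>omega\<close>, but with the closure of the
  ambient type; for subsets of the compact \<open>X\<close> it agrees with the relative
  closure.\<close>

definition orbit_tail :: "'a set \<Rightarrow> real \<Rightarrow> 'a set" where
  "orbit_tail U t = closure (\<Union>s\<in>{s \<in> Tplus T. t \<le> s}. \<phi> s ` U)"

lemma closure_subset_X: "U \<subseteq> X \<Longrightarrow> closure U \<subseteq> X"
  by (simp add: closure_minimal compact_imp_closed compact_space)

lemma closure_of_X: "U \<subseteq> X \<Longrightarrow> top_of_set X closure_of U = closure U"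
  using closure_subset_X by (auto simp: closure_of_subtopology Int_absorb1)

lemma orbit_subset_X: "U \<subseteq> X \<Longrightarrow> (\<Union>s\<in>{s \<in> Tplus T. t \<le> s}. \<phi> s ` U) \<subseteq> X"
  using image_subset_X by blast

lemma orbit_tail_subset_X: "U \<subseteq> X \<Longrightarrow> orbit_tail U t \<subseteq> X"
  unfolding orbit_tail_def by (intro closure_subset_X orbit_subset_X)

lemma compact_orbit_tail: "U \<subseteq> X \<Longrightarrow> compact (orbit_tail U t)"
  by (metis closed_closure compact_Int_closed compact_space inf.absorb2 orbit_tail_def
      orbit_tail_subset_X)

lemma orbit_tail_antimono: "s \<le> t \<Longrightarrow> orbit_tail U t \<subseteq> orbit_tail U s"
  unfolding orbit_tail_def by (intro closure_mono) force

lemma flow_image_subset_orbit_tail: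
  "s \<in> Tplus T \<Longrightarrow> t \<le> s \<Longrightarrow> \<phi> s ` U \<subseteq> orbit_tail U t"
  unfolding orbit_tail_def by (rule order_trans[OF _ closure_subset]) blast

text \<open>Tails decrease and the natural numbers are cofinal in either kind of time, so a sequence
  of compact sets suffices and nested intersection arguments become available.\<close>

lemma omega_eq_Inter_orbit_tail:
  assumes "U \<subseteq> X" shows "omega T X \<phi> U = (\<Inter>n::nat. orbit_tail U (real n))"
proof -
  have "omega T X \<phi> U = (\<Inter>t\<in>Tplus T. orbit_tail U t)"
    unfolding omega_def orbit_tail_def using closure_of_X[OF orbit_subset_X[OF assms]] by simp
  also have "\<dots> = (\<Inter>n::nat. orbit_tail U (real n))"
  proof
    show "(\<Inter>t\<in>Tplus T. orbit_tail U t) \<subseteq> (\<Inter>n::nat. orbit_tail U (real n))"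
      using Tplus_of_nat by blast
    show "(\<Inter>n::nat. orbit_tail U (real n)) \<subseteq> (\<Inter>t\<in>Tplus T. orbit_tail U t)"
    proof
      fix x assume x: "x \<in> (\<Inter>n::nat. orbit_tail U (real n))"
      have "x \<in> orbit_tail U t" for t
      proof -
        obtain n :: nat where "t \<le> real n" using real_arch_simple by blast
        then show ?thesis using x orbit_tail_antimono by blast
      qed
      then show "x \<in> (\<Inter>t\<in>Tplus T. orbit_tail U t)" by blast
    qed
  qed
  finally show ?thesis .
qed

text \<open>One inclusion is continuity; for the other, the image of the compact closure is compact,
  hence closed.\<close>

lemma flow_image_closure:
  assumes t: "t \<in> Tplus T" and S: "S \<subseteq> X"
  shows "\<phi> t ` closure S = closure (\<phi> t ` S)"
proof
  have cont: "continuous_on (closure S) (\<phi> t)"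
    using continuous_on_subset[OF continuous_on_flow[OF t]] closure_subset_X[OF S] by blast
  then show "\<phi> t ` closure S \<subseteq> closure (\<phi> t ` S)"
    by (intro image_closure_subset closed_closure closure_subset)
  have "compact (closure S)"
    by (metis S closed_closure closure_subset_X compact_Int_closed compact_space inf.absorb2)
  then have "compact (\<phi> t ` closure S)"
    by (rule compact_continuous_image[OF cont])
  then show "closure (\<phi> t ` S) \<subseteq> \<phi> t ` closure S"
    by (intro closure_minimal image_mono closure_subset compact_imp_closed)
qed

lemma flow_image_orbit_tail:
  assumes r: "r \<in> Tplus T" and U: "U \<subseteq> X" and t: "t \<in> Tplus T"
  shows "\<phi> r ` orbit_tail U t = orbit_tail U (t + r)"
proof -
  have "\<phi> r ` (\<Union>s\<in>{s \<in> Tplus T. t \<le> s}. \<phi> s ` U)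
      = (\<Union>s\<in>{s \<in> Tplus T. t \<le> s}. \<phi> (r + s) ` U)"
    unfolding image_UN using image_image_flow[OF _ r U] by auto
  also have "\<dots> = (\<Union>s\<in>((+) r) ` {s \<in> Tplus T. t \<le> s}. \<phi> s ` U)"
    by auto
  also have "((+) r) ` {s \<in> Tplus T. t \<le> s} = {s \<in> Tplus T. t + r \<le> s}"
  proof
    show "((+) r) ` {s \<in> Tplus T. t \<le> s} \<subseteq> {s \<in> Tplus T. t + r \<le> s}"
      using r Tplus_add by auto
    show "{s \<in> Tplus T. t + r \<le> s} \<subseteq> ((+) r) ` {s \<in> Tplus T. t \<le> s}"
    proof
      fix s assume s: "s \<in> {s \<in> Tplus T. t + r \<le> s}"
      \<comment> \<open>Since \<open>t\<close> is nonnegative, every time past \<open>t + r\<close>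
        is also past \<open>r\<close>, so \<open>s - r\<close> is an admissible time.\<close>
      then have "r \<le> s" using Tplus_nonneg[OF t] by auto
      then have "s - r \<in> {s \<in> Tplus T. t \<le> s}" using s Tplus_diff[OF r] by auto
      then show "s \<in> ((+) r) ` {s \<in> Tplus T. t \<le> s}" by force
    qed
  qed
  finally show ?thesis
    unfolding orbit_tail_def using flow_image_closure[OF r orbit_subset_X[OF U]] by simp
qed

text \<open>Flowing for time \<open>r\<close> turns each tail into a later one, which gives forward
  invariance. Surjectivity needs a single preimage lying in all tails at once; compactness supplies
  it.\<close>

lemma invariant_omega:
  assumes U: "U \<subseteq> X" shows "invariant_set T X \<phi> (omega T X \<phi> U)"
  unfolding invariant_set_def
proof (intro conjI ballI)
  show "omega T X \<phi> U \<subseteq> X"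
    using orbit_tail_subset_X[OF U] by (auto simp: omega_eq_Inter_orbit_tail[OF U])
  fix r assume r: "r \<in> Tplus T"
  show "\<phi> r ` omega T X \<phi> U = omega T X \<phi> U"
  proof
    have "\<phi> r ` orbit_tail U (real n) \<subseteq> orbit_tail U (real n)" for n
      using flow_image_orbit_tail[OF r U Tplus_of_nat] orbit_tail_antimono Tplus_nonneg[OF r]
      by simp
    then show "\<phi> r ` omega T X \<phi> U \<subseteq> omega T X \<phi> U"
      by (auto simp: omega_eq_Inter_orbit_tail[OF U])
    show "omega T X \<phi> U \<subseteq> \<phi> r ` omega T X \<phi> U"
    proof
      fix x assume x: "x \<in> omega T X \<phi> U"
      \<comment> \<open>The preimages of \<open>x\<close> in the tails form a decreasing sequence of
        nonempty compact sets; a common point is a preimage in the limit set.\<close>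
      define F where "F n = {y \<in> orbit_tail U (real n). \<phi> r y = x}" for n
      have F: "compact (F n)" for n
      proof -
        have "closed (F n)"
          unfolding F_def
          by (intro continuous_closed_preimage_constant compact_imp_closed compact_orbit_tail U
              continuous_on_subset[OF continuous_on_flow[OF r] orbit_tail_subset_X])
        then have "compact (orbit_tail U (real n) \<inter> F n)"
          by (intro compact_Int_closed compact_orbit_tail U)
        moreover have "orbit_tail U (real n) \<inter> F n = F n" by (auto simp: F_def)
        ultimately show ?thesis by simp
      qed
      have "F n \<noteq> {}" for n
      proof -
        obtain m :: nat where m: "real n + r \<le> real m" using real_arch_simple by blast
        have "x \<in> orbit_tail U (real n + r)"
          using x orbit_tail_antimono[OF m] by (auto simp: omega_eq_Inter_orbit_tail[OF U])
        then have "x \<in> \<phi> r ` orbit_tail U (real n)"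
          by (simp add: flow_image_orbit_tail[OF r U Tplus_of_nat])
        then show ?thesis unfolding F_def by blast
      qed
      moreover have "F n \<subseteq> F m" if "m \<le> n" for m n
        using orbit_tail_antimono[of "real m" "real n"] that unfolding F_def by auto
      ultimately have "(\<Inter>n. F n) \<noteq> {}"
        using F by (intro compact_decseq_Inter_nonempty) auto
      then obtain y where "\<And>n. y \<in> F n" by blast
      then show "x \<in> \<phi> r ` omega T X \<phi> U"
        by (auto simp: F_def omega_eq_Inter_orbit_tail[OF U])
    qed
  qed
qed

text \<open>The parts of the tails outside an open set containing the limit set are compact and
  decreasing with empty intersection, so one of them is empty.\<close>

lemma orbit_tail_eventually_subset:
  assumes U: "U \<subseteq> X" and W: "openin (top_of_set X) W" and sub: "omega T X \<phi> U \<subseteq> W"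
  obtains n :: nat where "0 < n" "orbit_tail U (real n) \<subseteq> W"
proof -
  obtain G where G: "open G" "W = X \<inter> G" using W by (auto simp: openin_open)
  have "\<exists>n. orbit_tail U (real n) - G = {}"
  proof (rule ccontr)
    assume "\<nexists>n. orbit_tail U (real n) - G = {}"
    moreover have "compact (orbit_tail U (real n) - G)" for n
      using G(1) U by (intro compact_diff compact_orbit_tail)
    moreover have "orbit_tail U (real n) - G \<subseteq> orbit_tail U (real m) - G" if "m \<le> n" for m n
      using orbit_tail_antimono[of "real m" "real n"] that by auto
    ultimately have "(\<Inter>n. orbit_tail U (real n) - G) \<noteq> {}"
      by (intro compact_decseq_Inter_nonempty) auto
    then show False using sub G(2) by (auto simp: omega_eq_Inter_orbit_tail[OF U])
  qed
  then obtain n where "orbit_tail U (real n) \<subseteq> G" by blast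
  \<comment> \<open>Passing to \<open>Suc n\<close> makes the time positive, as the definition of a
    trapping region demands.\<close>
  then have "orbit_tail U (real (Suc n)) \<subseteq> W"
    using orbit_tail_antimono[of "real n" "real (Suc n)" U] orbit_tail_subset_X[OF U] G(2)
    by fastforce
  then show ?thesis using that by blast
qed

lemma omega_mono:
  assumes "U \<subseteq> V" shows "omega T X \<phi> U \<subseteq> omega T X \<phi> V"
  unfolding omega_def using assms by (intro INF_mono' closure_of_mono UN_mono image_mono) auto

lemma omega_empty: "omega T X \<phi> {} = {}"
  using omega_eq_Inter_orbit_tail[of "{}"] by (simp add: orbit_tail_def)

text \<open>A point outside both limit sets misses a tail of \<open>U\<close> and a tail of
  \<open>V\<close>. By monotonicity it misses both at the larger of the two times, hence a tail of
  the union.\<close>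

lemma omega_Un:
  assumes U: "U \<subseteq> X" and V: "V \<subseteq> X"
  shows "omega T X \<phi> (U \<union> V) = omega T X \<phi> U \<union> omega T X \<phi> V"
proof
  have tail: "orbit_tail (U \<union> V) t = orbit_tail U t \<union> orbit_tail V t" for t
    unfolding orbit_tail_def by (simp add: image_Un UN_Un_distrib flip: closure_Un)
  show "omega T X \<phi> (U \<union> V) \<subseteq> omega T X \<phi> U \<union> omega T X \<phi> V"
  proof (rule ccontr)
    assume "\<not> ?thesis"
    then obtain x m n where x: "x \<in> omega T X \<phi> (U \<union> V)"
        and mn: "x \<notin> orbit_tail U (real m)" "x \<notin> orbit_tail V (real n)"
      unfolding omega_eq_Inter_orbit_tail[OF U] omega_eq_Inter_orbit_tail[OF V] by blast
    have "x \<in> orbit_tail (U \<union> V) (real (max m n))"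
      using x U V by (auto simp: omega_eq_Inter_orbit_tail)
    then show False
      using mn orbit_tail_antimono[of "real m" "real (max m n)" U]
        orbit_tail_antimono[of "real n" "real (max m n)" V] by (auto simp: tail)
  qed
qed (simp add: omega_mono)

text \<open>The invariant part of \<open>U\<close> is its own image at every time, so it is
  contained in every tail.\<close>

lemma Inv_subset_omega:
  assumes U: "U \<subseteq> X" shows "Inv T X \<phi> U \<subseteq> omega T X \<phi> U"
proof -
  have "Inv T X \<phi> U \<subseteq> orbit_tail U (real n)" for n
  proof -
    have "Inv T X \<phi> U = \<phi> (real n) ` Inv T X \<phi> U"
      using invariant_Inv[of T X \<phi> U] Tplus_of_nat unfolding invariant_set_def by auto
    also have "\<dots> \<subseteq> \<phi> (real n) ` U" by (intro image_mono Inv_subset)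
    also have "\<dots> \<subseteq> orbit_tail U (real n)"
      by (intro flow_image_subset_orbit_tail Tplus_of_nat) simp
    finally show ?thesis .
  qed
  then show ?thesis by (auto simp: omega_eq_Inter_orbit_tail[OF U])
qed

section \<open>Attracting neighbourhoods and trapping regions\<close>

lemma omega_attracting_nbhd:
  assumes "attracting_nbhd T X \<phi> U" shows "omega T X \<phi> U = Inv T X \<phi> U"
proof
  have "U \<subseteq> X" "omega T X \<phi> U \<subseteq> U"
    using assms interior_of_subset[of "top_of_set X" U] by (auto simp: attracting_nbhd_def)
  then show "omega T X \<phi> U \<subseteq> Inv T X \<phi> U" "Inv T X \<phi> U \<subseteq> omega T X \<phi> U"
    by (auto intro!: Inv_maximal invariant_omega Inv_subset_omega del: subsetI)
qed

lemma attracting_nbhd_empty: "attracting_nbhd T X \<phi> {}"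
  by (simp add: attracting_nbhd_def omega_empty)

lemma attracting_nbhd_space: "attracting_nbhd T X \<phi> X"
proof -
  have "top_of_set X interior_of X = X"
    using interior_of_topspace[of "top_of_set X"] by simp
  then show ?thesis
    using invariant_omega[of X] by (simp add: attracting_nbhd_def invariant_set_def)
qed

lemma attracting_nbhd_Un:
  assumes "attracting_nbhd T X \<phi> U" "attracting_nbhd T X \<phi> V"
  shows "attracting_nbhd T X \<phi> (U \<union> V)"
  using assms interior_of_mono[of U "U \<union> V" "top_of_set X"]
    interior_of_mono[of V "U \<union> V" "top_of_set X"]
  by (auto simp: attracting_nbhd_def omega_Un)

lemma attracting_nbhd_Int:
  assumes "attracting_nbhd T X \<phi> U" "attracting_nbhd T X \<phi> V"
  shows "attracting_nbhd T X \<phi> (U \<inter> V)"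
  using assms omega_mono[of "U \<inter> V" U] omega_mono[of "U \<inter> V" V]
  by (auto simp: attracting_nbhd_def interior_of_Int)

lemma bdd_distrib_lattice_ANbhd: "bdd_distrib_lattice (ANbhd T X \<phi>)"
  by unfold_locales
    (auto simp: ANbhd_def attracting_nbhd_Un attracting_nbhd_Int attracting_nbhd_empty
      attracting_nbhd_space, auto simp: attracting_nbhd_def)

text \<open>Forward invariance puts the limit set inside \<open>closure U\<close>. Being invariant,
  the limit set equals its image under \<open>\<phi> \<tau>\<close>, which the trapping condition
  places in the interior.\<close>

lemma trapping_imp_attracting_nbhd:
  assumes "trapping_region T X \<phi> U" shows "attracting_nbhd T X \<phi> U"
proof -
  have U: "U \<subseteq> X" and fwd: "\<And>t. t \<in> Tplus T \<Longrightarrow> \<phi> t ` U \<subseteq> U"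
    using assms unfolding trapping_region_def forward_invariant_def by blast+
  obtain \<tau> where "\<tau> \<in> T" "0 < \<tau>" and trap: "\<phi> \<tau> ` closure U \<subseteq> top_of_set X interior_of U"
    using assms unfolding trapping_region_def closure_of_X[OF U] by blast
  then have \<tau>: "\<tau> \<in> Tplus T" by (simp add: Tplus_def)
  have tail0: "orbit_tail U 0 \<subseteq> closure U"
    unfolding orbit_tail_def using fwd by (intro closure_mono) blast
  have "omega T X \<phi> U = \<phi> \<tau> ` omega T X \<phi> U"
    using invariant_omega[OF U] \<tau> by (auto simp: invariant_set_def)
  also have "omega T X \<phi> U \<subseteq> orbit_tail U (real 0)"
    unfolding omega_eq_Inter_orbit_tail[OF U] by blast
  then have "\<phi> \<tau> ` omega T X \<phi> U \<subseteq> \<phi> \<tau> ` closure U"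
    using tail0 by auto
  also note trap
  finally show ?thesis using U by (simp add: attracting_nbhd_def)
qed

text \<open>This is the tube lemma for a bounded time interval: the pairs of a time and a point that
  the flow sends outside \<open>N\<close> form the compact set \<open>C\<close>, and its projection
  to \<open>X\<close> is the complement of the set in question.\<close>

lemma openin_stay_in:
  assumes N: "openin (top_of_set X) N"
  shows "openin (top_of_set X) {x \<in> X. \<forall>s\<in>Tplus T. s \<le> b \<longrightarrow> \<phi> s x \<in> N}"
proof -
  define I where "I = Tplus T \<inter> {0..b}"
  define C where "C = {p \<in> I \<times> X. (\<lambda>(t, x). \<phi> t x) p \<in> X - N}"
  have "compact I"
    unfolding I_def by (intro closed_Int_compact Tplus_closed compact_Icc)
  then have IX: "compact (I \<times> X)"
    using compact_space by (rule compact_Times)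
  have "closedin (top_of_set X) (X - N)"
    using N by (simp add: closedin_diff)
  then have "closed (X - N)"
    using closedin_closed_trans compact_imp_closed compact_space by blast
  moreover have "continuous_on (I \<times> X) (\<lambda>(t, x). \<phi> t x)"
    by (rule continuous_on_subset[OF continuous]) (auto simp: I_def)
  ultimately have "closed (I \<times> X \<inter> (\<lambda>(t, x). \<phi> t x) -` (X - N))"
    using compact_imp_closed[OF IX] by (intro continuous_closed_preimage)
  then have "compact (I \<times> X \<inter> (I \<times> X \<inter> (\<lambda>(t, x). \<phi> t x) -` (X - N)))"
    using IX by (intro compact_Int_closed)
  moreover have "I \<times> X \<inter> (I \<times> X \<inter> (\<lambda>(t, x). \<phi> t x) -` (X - N)) = C"
    by (auto simp: C_def)
  ultimately have "compact (snd ` C)"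
    by (intro compact_continuous_image continuous_intros) simp
  then have "openin (top_of_set X) (X - snd ` C)"
    using openin_open_Int[of "- snd ` C" X] by (simp add: Diff_eq open_Compl compact_imp_closed)
  moreover have "X - snd ` C = {x \<in> X. \<forall>s\<in>Tplus T. s \<le> b \<longrightarrow> \<phi> s x \<in> N}"
    using maps_to Tplus_nonneg by (force simp: C_def I_def image_iff)
  ultimately show ?thesis by simp
qed

text \<open>The trapping region is \<open>V\<close>, the points whose forward orbit stays in
  \<open>U\<close>. Forward invariance of \<open>V\<close> is immediate, but its interior is hard to
  see directly; the relatively open set \<open>W\<close> with
  \<open>A \<subseteq> W \<subseteq> V\<close> supplies enough of it.\<close>

lemma omega_attracting_nbhd_in_Att:
  assumes attr: "attracting_nbhd T X \<phi> U" shows "omega T X \<phi> U \<in> Att T X \<phi>"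
proof -
  define N where "N = top_of_set X interior_of U"
  define A where "A = omega T X \<phi> U"
  have U: "U \<subseteq> X" and AN: "A \<subseteq> N" and NU: "N \<subseteq> U"
    using attr interior_of_subset[of "top_of_set X" U]
    by (simp_all add: attracting_nbhd_def N_def A_def)
  have N: "openin (top_of_set X) N" by (simp add: N_def)
  have A: "invariant_set T X \<phi> A" unfolding A_def by (rule invariant_omega[OF U])
  \<comment> \<open>From time \<open>n\<close> on, all of \<open>U\<close> is carried into
    \<open>N\<close>, so staying in \<open>U\<close> forever has to be checked only up to time
    \<open>n\<close>.\<close>
  obtain n where n: "orbit_tail U (real n) \<subseteq> N"
    using orbit_tail_eventually_subset[OF U N] AN unfolding A_def by blast
  define V where "V = {x \<in> X. \<forall>s\<in>Tplus T. \<phi> s x \<in> U}"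
  define W where "W = {x \<in> X. \<forall>s\<in>Tplus T. s \<le> real n \<longrightarrow> \<phi> s x \<in> N}"
  have W: "openin (top_of_set X) W" unfolding W_def by (rule openin_stay_in[OF N])
  have AW: "A \<subseteq> W"
    using A AN unfolding W_def invariant_set_def by blast
  have VU: "V \<subseteq> U"
    using initial Tplus_of_nat[of 0] unfolding V_def by force
  have WV: "W \<subseteq> V"
  proof
    fix x assume x: "x \<in> W"
    then have "x \<in> U" and "x \<in> X"
      using initial Tplus_of_nat[of 0] NU unfolding W_def by force+
    moreover have "\<phi> s x \<in> U" if s: "s \<in> Tplus T" for s
    proof (cases "s \<le> real n")
      case True
      then show ?thesis using x s NU unfolding W_def by blast
    next
      case False
      then have "\<phi> s ` U \<subseteq> N"
        using flow_image_subset_orbit_tail[OF s, of "real n" U] n by auto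
      then show ?thesis using \<open>x \<in> U\<close> NU by blast
    qed
    ultimately show "x \<in> V" unfolding V_def by blast
  qed
  have V: "V \<subseteq> X" unfolding V_def by blast
  have fwd: "forward_invariant T X \<phi> V"
    unfolding forward_invariant_def V_def by (auto simp: semigroup maps_to intro: Tplus_add)
  obtain m :: nat where m: "0 < m" "orbit_tail U (real m) \<subseteq> W"
    using orbit_tail_eventually_subset[OF U W] AW unfolding A_def by blast
  have "\<phi> (real m) ` closure V = closure (\<phi> (real m) ` V)"
    by (rule flow_image_closure[OF Tplus_of_nat V])
  also have "\<dots> \<subseteq> orbit_tail U (real m)"
  proof (rule closure_minimal)
    show "\<phi> (real m) ` V \<subseteq> orbit_tail U (real m)"
      using flow_image_subset_orbit_tail[OF Tplus_of_nat order_refl, of m U] VU by blast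
  qed (simp add: orbit_tail_def)
  also have "\<dots> \<subseteq> top_of_set X interior_of V"
    using m(2) interior_of_maximal[OF WV W] by blast
  finally have "trapping_region T X \<phi> V"
    unfolding trapping_region_def using fwd m(1) Tplus_of_nat[of m]
    by (intro conjI bexI[of _ "real m"]) (auto simp: closure_of_X[OF V] Tplus_def)
  moreover have "Inv T X \<phi> V = A"
  proof
    show "Inv T X \<phi> V \<subseteq> A"
      using Inv_mono[OF VU] omega_attracting_nbhd[OF attr] by (simp add: A_def)
    show "A \<subseteq> Inv T X \<phi> V"
      using AW WV by (intro Inv_maximal[OF A]) blast
  qed
  ultimately show ?thesis unfolding Att_def A_def by blast
qed

section \<open>The lattice of attractors and the homomorphism \<open>omega\<close>\<close>

lemma omega_image_ANbhd: "omega T X \<phi> ` car (ANbhd T X \<phi>) = Att T X \<phi>"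
proof
  show "omega T X \<phi> ` car (ANbhd T X \<phi>) \<subseteq> Att T X \<phi>"
    using omega_attracting_nbhd_in_Att by (auto simp: ANbhd_def)
  show "Att T X \<phi> \<subseteq> omega T X \<phi> ` car (ANbhd T X \<phi>)"
    using trapping_imp_attracting_nbhd omega_attracting_nbhd by (fastforce simp: ANbhd_def Att_def)
qed

text \<open>Both sides reduce to \<open>Inv T X \<phi> (U \<inter> V)\<close>, as
  \<open>omega\<close> and \<open>Inv\<close> agree on attracting neighbourhoods.\<close>

lemma omega_Int:
  assumes "attracting_nbhd T X \<phi> U" "attracting_nbhd T X \<phi> V"
  shows "omega T X \<phi> (U \<inter> V) = Inv T X \<phi> (omega T X \<phi> U \<inter> omega T X \<phi> V)"
  using assms
  by (simp add: omega_attracting_nbhd attracting_nbhd_Int Inv_Int_Inv_left Inv_Int_Inv_right)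

lemma omega_space: "omega T X \<phi> X = Inv T X \<phi> X"
  by (rule omega_attracting_nbhd[OF attracting_nbhd_space])

text \<open>Every attractor is the limit set of an attracting neighbourhood, so closure under join
  and meet is inherited from unions and intersections of such neighbourhoods; the bounds come from
  the empty set and \<open>X\<close>.\<close>

lemma bdd_sublattice_Att: "bdd_sublattice (Invset T X \<phi>) (Att T X \<phi>)"
proof -
  interpret bdd_distrib_lattice "Invset T X \<phi>" by (rule bdd_distrib_lattice_Invset)
  have obt: "\<exists>U. attracting_nbhd T X \<phi> U \<and> U \<subseteq> X \<and> x = omega T X \<phi> U" if "x \<in> Att T X \<phi>" for x
  proof -
    have "x \<in> omega T X \<phi> ` car (ANbhd T X \<phi>)"
      using that by (simp add: omega_image_ANbhd)
    then show ?thesis by (auto simp: ANbhd_def attracting_nbhd_def)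
  qed
  show ?thesis
  proof
    show "Att T X \<phi> \<subseteq> car (Invset T X \<phi>)"
      using invariant_Inv by (auto simp: Att_def Invset_def)
    fix x y assume "x \<in> Att T X \<phi>" "y \<in> Att T X \<phi>"
    then obtain U V where U: "attracting_nbhd T X \<phi> U" "U \<subseteq> X" "x = omega T X \<phi> U"
      and V: "attracting_nbhd T X \<phi> V" "V \<subseteq> X" "y = omega T X \<phi> V"
      using obt by meson
    show "join (Invset T X \<phi>) x y \<in> Att T X \<phi>"
      using omega_attracting_nbhd_in_Att[OF attracting_nbhd_Un[OF U(1) V(1)]] U V
      by (simp add: Invset_def omega_Un)
    show "meet (Invset T X \<phi>) x y \<in> Att T X \<phi>"
      using omega_attracting_nbhd_in_Att[OF attracting_nbhd_Int[OF U(1) V(1)]] U V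
      by (simp add: Invset_def omega_Int)
  next
    show "zero (Invset T X \<phi>) \<in> Att T X \<phi>"
      using omega_attracting_nbhd_in_Att[OF attracting_nbhd_empty]
      by (simp add: Invset_def omega_empty)
    show "one (Invset T X \<phi>) \<in> Att T X \<phi>"
      using omega_attracting_nbhd_in_Att[OF attracting_nbhd_space]
      by (simp add: Invset_def omega_space)
  qed
qed

end

text \<open>This provides the codomain of the homomorphism: the attractors with the operations and
  bounds of the ambient lattice.\<close>

lemma (in bdd_sublattice) bdd_lattice_restrict: "bdd_lattice (L\<lparr>car := K\<rparr>)"
  by unfold_locales
    (simp_all add: sub_join sub_meet sub_zero sub_one join_assoc meet_assoc join_meet_absorb
      meet_join_absorb join_zero meet_one subsetD[OF sub_subset],
      simp_all add: subsetD[OF sub_subset] join_commute meet_commute)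

lemma (in compact_dynamical_system) bdd_lattice_hom_omega:
  "bdd_lattice_hom (ANbhd T X \<phi>) ((Invset T X \<phi>)\<lparr>car := Att T X \<phi>\<rparr>) (omega T X \<phi>)"
proof -
  interpret D: bdd_distrib_lattice "ANbhd T X \<phi>" by (rule bdd_distrib_lattice_ANbhd)
  interpret C: bdd_lattice "(Invset T X \<phi>)\<lparr>car := Att T X \<phi>\<rparr>"
    by (rule bdd_sublattice.bdd_lattice_restrict[OF bdd_sublattice_Att])
  show ?thesis
  proof
    fix U V assume "U \<in> car (ANbhd T X \<phi>)" "V \<in> car (ANbhd T X \<phi>)"
    then have UV: "attracting_nbhd T X \<phi> U" "attracting_nbhd T X \<phi> V" "U \<subseteq> X" "V \<subseteq> X"
      by (auto simp: ANbhd_def attracting_nbhd_def)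
    then show "omega T X \<phi> (join (ANbhd T X \<phi>) U V)
        = join ((Invset T X \<phi>)\<lparr>car := Att T X \<phi>\<rparr>) (omega T X \<phi> U) (omega T X \<phi> V)"
      and "omega T X \<phi> (meet (ANbhd T X \<phi>) U V)
        = meet ((Invset T X \<phi>)\<lparr>car := Att T X \<phi>\<rparr>) (omega T X \<phi> U) (omega T X \<phi> V)"
      by (simp_all add: ANbhd_def Invset_def omega_Un omega_Int)
  qed (use omega_image_ANbhd in \<open>auto simp: ANbhd_def Invset_def omega_empty omega_space\<close>)
qed

theorem proposition4p3:
  fixes T :: "real set" and X :: "'a::metric_space set" and \<phi> :: "real \<Rightarrow> 'a \<Rightarrow> 'a"
  assumes "compact X"
    and "dynamical_system T X \<phi>"
  shows "bdd_distrib_lattice (Invset T X \<phi>) \<and>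
         bdd_sublattice (Invset T X \<phi>) (Att T X \<phi>) \<and>
         bdd_distrib_lattice (ANbhd T X \<phi>) \<and>
         bdd_lattice_hom (ANbhd T X \<phi>) ((Invset T X \<phi>)\<lparr>car := Att T X \<phi>\<rparr>) (omega T X \<phi>) \<and>
         omega T X \<phi> ` car (ANbhd T X \<phi>) = Att T X \<phi>"
proof -
  interpret compact_dynamical_system T X \<phi>
    using assms by (intro compact_dynamical_system.intro compact_dynamical_system_axioms.intro)
  show ?thesis
    using bdd_distrib_lattice_Invset bdd_sublattice_Att bdd_distrib_lattice_ANbhd
      bdd_lattice_hom_omega omega_image_ANbhd by blast
qed

end
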